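(* Let $S=-\sum_{i=1}^n x_i\log x_i$ be the Shannon entropy function defined on $\{(x_1,\dots,x_n): x_i>0 \text{ for all } i\}$ (the condition $\sum_i x_i=1$ is lifted). Let $s_1,\dots,s_n$ be the elementary symmetric polynomials of $x_1,\dots,x_n$, and, near points where the $x_i$ are pairwise distinct, view $S$ as a function of the local coordinates $$t_1=\frac{1}{s_1},\quad t_2=\frac{s_2}{s_1},\quad\dots,\quad t_n=\frac{s_n}{s_1}.$$ Then at every point with pairwise distinct $x_i>0$ and $s_1=\sum_i x_i=1$, the subentropy is given by $$Q(x_1,\dots,x_n)=1-\frac{\partial S}{\partial t_1},$$ where the partial derivative is taken with $t_2,\dots,t_n$ held fixed.
   Context: The elementary symmetric polynomials are $s_i=\sum_{1\le u_1<\dots<u_i\le n}x_{u_1}\cdots x_{u_i}$ for $i=1,\dots,n$. The subentropy of pairwise distinct positive numbers $x_1,\dots,x_n$ is $$Q(x_1,\dots,x_n)=-\sum_{k=1}^n\frac{x_k^n\log x_k}{\prod_{i\ne k}(x_k-x_i)}.$$ $\log$ denotes the natural logarithm. At points where the $x_i$ are positive and pairwise distinct, the map $(x_1,\dots,x_n)\mapsto(t_1,\dots,t_n)$ is a local diffeomorphism, so $S$ is locally a smooth function of $(t_1,\dots,t_n)$. *)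

theory Defs
  imports "HOL-Analysis.Analysis"
begin

definition esym :: "nat \<Rightarrow> real ^ 'n \<Rightarrow> real" where
  "esym k x = (\<Sum>A | A \<subseteq> (UNIV :: 'n set) \<and> card A = k. \<Prod>i\<in>A. x $ i)"

definition shannon_entropy :: "real ^ 'n \<Rightarrow> real" where
  "shannon_entropy x = - (\<Sum>i\<in>UNIV. x $ i * ln (x $ i))"

definition subentropy :: "real ^ 'n \<Rightarrow> real" where
  "subentropy x =
     - (\<Sum>k\<in>UNIV. x $ k ^ CARD('n) * ln (x $ k) / (\<Prod>i\<in>UNIV - {k}. x $ k - x $ i))"

definition distinct_positive :: "(real ^ 'n) set" where
  "distinct_positive = {x. (\<forall>i. x $ i > 0) \<and> (\<forall>i j. i \<noteq> j \<longrightarrow> x $ i \<noteq> x $ j)}"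

text \<open>
  The index type \<open>'n\<close> carries no order, so the coordinates are numbered by a bijection
  \<open>idx\<close> from \<open>'n\<close> onto \<open>{1..CARD('n)}\<close>: the component at \<open>j\<close> is the coordinate \<open>t\<close> with
  number \<open>idx j\<close>.
\<close>

definition tcoords :: "('n \<Rightarrow> nat) \<Rightarrow> real ^ 'n \<Rightarrow> real ^ 'n" where
  "tcoords idx x =
     (\<chi> j. if idx j = 1 then 1 / esym 1 x else esym (idx j) x / esym 1 x)"

definition C1_on :: "'a::real_normed_vector set \<Rightarrow> ('a \<Rightarrow> 'b::real_normed_vector) \<Rightarrow> bool" where
  "C1_on U f \<longleftrightarrow> (\<forall>u\<in>U. f differentiable (at u)) \<and>
     (\<forall>v. continuous_on U (\<lambda>u. frechet_derivative f (at u) v))"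

text \<open>
  \<open>is_local_chart M t a U V g\<close>: the map \<open>t\<close> restricts to a \<open>C\<^sup>1\<close> diffeomorphism, with inverse \<open>g\<close>,
  from the open neighbourhood \<open>U \<subseteq> M\<close> of \<open>a\<close> onto the open set \<open>V\<close>.
\<close>

definition is_local_chart ::
    "(real ^ 'n) set \<Rightarrow> (real ^ 'n \<Rightarrow> real ^ 'n) \<Rightarrow> real ^ 'n \<Rightarrow>
     (real ^ 'n) set \<Rightarrow> (real ^ 'n) set \<Rightarrow> (real ^ 'n \<Rightarrow> real ^ 'n) \<Rightarrow> bool" where
  "is_local_chart M t a U V g \<longleftrightarrow>
     open U \<and> a \<in> U \<and> U \<subseteq> M \<and> open V \<and> homeomorphism U V t g \<and> C1_on U t \<and> C1_on V g"

text \<open>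
  Partial derivative at \<open>a\<close> of \<open>F\<close>, viewed as the function \<open>F \<circ> g\<close> of the local coordinates \<open>t\<close>,
  with respect to the \<open>j\<close>-th coordinate, the others being held fixed.  A chart around \<open>a\<close> is
  required to exist, and every chart around \<open>a\<close> must give the value \<open>D\<close>; hence \<open>D\<close> is unique.
\<close>

definition has_coord_partial ::
    "(real ^ 'n) set \<Rightarrow> (real ^ 'n \<Rightarrow> real ^ 'n) \<Rightarrow> (real ^ 'n \<Rightarrow> real) \<Rightarrow> 'n \<Rightarrow> real \<Rightarrow>
     real ^ 'n \<Rightarrow> bool" where
  "has_coord_partial M t F j D a \<longleftrightarrow>
     (\<exists>U V g. is_local_chart M t a U V g) \<and>
     (\<forall>U V g. is_local_chart M t a U V g \<longrightarrow>
        ((\<lambda>\<tau>. F (g (\<chi> i. if i = j then \<tau> else t a $ i))) has_real_derivative D) (at (t a $ j)))"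

end

theory Submission
  imports Defs
begin

text \<open>
  Along the first coordinate line through \<open>x\<close>, parametrised by \<open>\<tau> = t\<^sub>1\<close>, one has
  \<open>s\<^sub>k(\<tau>) = s\<^sub>k(x) / \<tau>\<close> for all \<open>k \<ge> 1\<close>, so the monic polynomial \<open>P\<^sub>\<tau>\<close> whose roots are the moving
  coordinates satisfies \<open>P\<^sub>\<tau>(z) = z\<^sup>n + (P\<^sub>1(z) - z\<^sup>n) / \<tau>\<close>.  Differentiating at \<open>\<tau> = 1\<close>
  and evaluating at the root \<open>z = x\<^sub>k\<close> gives the root velocity \<open>- x\<^sub>k\<^sup>n / \<Prod>\<^sub>i (x\<^sub>k - x\<^sub>i)\<close>.  The
  velocities add up to \<open>-1\<close>, the derivative of \<open>s\<^sub>1 = 1 / \<tau>\<close>, and the chain rule for \<open>S\<close> gives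
  the formula.  The same evaluation at the roots shows that the Jacobian of the coordinate map is
  invertible, so that charts exist by the inverse function theorem.
\<close>

subsection \<open>Elementary symmetric polynomials\<close>

lemma esym_0: "esym 0 x = 1"
proof -
  have "{A. A \<subseteq> (UNIV :: 'a set) \<and> card A = 0} = {{}}" by auto
  then show ?thesis by (simp add: esym_def)
qed

lemma esym_1: "esym 1 x = (\<Sum>i\<in>UNIV. x $ i)"
proof -
  have "{A. A \<subseteq> (UNIV :: 'a set) \<and> card A = 1} = (\<lambda>i. {i}) ` UNIV"
    by (auto simp: card_1_singleton_iff)
  then show ?thesis by (simp add: esym_def sum.reindex)
qed

text \<open>Vieta's formula: expand the product over the set \<open>A\<close> of factors
  contributing \<open>- x $ i\<close>, then group the sets by size.\<close>

lemma prod_diff_eq_esym: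
  fixes x :: "real ^ 'n"
  shows "(\<Prod>i\<in>UNIV. z - x $ i) = (\<Sum>k\<le>CARD('n). (-1) ^ k * z ^ (CARD('n) - k) * esym k x)"
proof -
  have "(\<Prod>i\<in>UNIV. z - x $ i)
      = (\<Sum>A\<in>Pow UNIV. (-1) ^ card A * (\<Prod>i\<in>A. x $ i) * (\<Prod>i\<in>UNIV - A. z))"
    by (rule prod_diff_conv_sum) simp
  also have "\<dots> = (\<Sum>A\<in>Pow UNIV. (-1) ^ card A * z ^ (CARD('n) - card A) * (\<Prod>i\<in>A. x $ i))"
    by (intro sum.cong) (auto simp: card_Diff_subset)
  also have "\<dots> = (\<Sum>k\<le>CARD('n). \<Sum>A | A \<in> Pow UNIV \<and> card A = k.
      (-1) ^ card A * z ^ (CARD('n) - card A) * (\<Prod>i\<in>A. x $ i))"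
    by (rule sum.group[symmetric]) (auto intro: card_mono)
  also have "\<dots> = (\<Sum>k\<le>CARD('n). (-1) ^ k * z ^ (CARD('n) - k) * esym k x)"
    unfolding esym_def sum_distrib_left by (intro sum.cong) auto
  finally show ?thesis .
qed

text \<open>The product rule on each monomial. Being an explicit polynomial in \<open>x\<close>, it
  is visibly continuous for fixed \<open>v\<close>.\<close>

definition esym_deriv :: "nat \<Rightarrow> real ^ 'n \<Rightarrow> real ^ 'n \<Rightarrow> real" where
  "esym_deriv k x v =
     (\<Sum>A | A \<subseteq> (UNIV :: 'n set) \<and> card A = k. \<Sum>i\<in>A. v $ i * (\<Prod>j\<in>A - {i}. x $ j))"

lemma has_derivative_esym [derivative_intros]:
  "(esym k has_derivative esym_deriv k x) (at x)"
proof -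
  have "((\<lambda>x. esym k x) has_derivative (\<lambda>v. esym_deriv k x v)) (at x)"
    unfolding esym_def esym_deriv_def
    by (intro has_derivative_sum has_derivative_prod bounded_linear_imp_has_derivative
        bounded_linear_vec_nth)
  then show ?thesis .
qed

lemma continuous_on_esym [continuous_intros]: "continuous_on S (esym k)"
  unfolding esym_def by (intro continuous_intros)

lemma continuous_on_esym_deriv [continuous_intros]:
  "continuous_on S (\<lambda>x. esym_deriv k x v)"
  unfolding esym_deriv_def by (intro continuous_intros)

text \<open>The monic polynomial with moving roots is evaluated at a fixed point that is its
  \<open>k\<close>-th root at time \<open>\<tau>\<close>. In the product rule every term but the
  \<open>k\<close>-th keeps the vanishing factor.\<close>

lemma has_real_derivative_prod_diff_root:
  fixes \<gamma> :: "real \<Rightarrow> real ^ 'n"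
  assumes "(\<gamma> has_vector_derivative v) (at \<tau>)"
  shows "((\<lambda>s. \<Prod>i\<in>UNIV. \<gamma> \<tau> $ k - \<gamma> s $ i) has_real_derivative
           - (v $ k * (\<Prod>i\<in>UNIV - {k}. \<gamma> \<tau> $ k - \<gamma> \<tau> $ i))) (at \<tau>)"
proof -
  have "((\<lambda>s. \<gamma> s $ i) has_derivative (\<lambda>h. h * v $ i)) (at \<tau>)" for i
    using bounded_linear.has_derivative[OF bounded_linear_vec_nth
        assms[unfolded has_vector_derivative_def], of i] by simp
  then have "((\<lambda>s. \<Prod>i\<in>UNIV. \<gamma> \<tau> $ k - \<gamma> s $ i) has_derivative
      (\<lambda>h. \<Sum>i\<in>UNIV. (0 - h * v $ i) * (\<Prod>j\<in>UNIV - {i}. \<gamma> \<tau> $ k - \<gamma> \<tau> $ j))) (at \<tau>)"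
    by (intro has_derivative_prod has_derivative_diff has_derivative_const)
  moreover have "h * - (v $ k * (\<Prod>i\<in>UNIV - {k}. \<gamma> \<tau> $ k - \<gamma> \<tau> $ i))
      = (\<Sum>i\<in>UNIV. (0 - h * v $ i) * (\<Prod>j\<in>UNIV - {i}. \<gamma> \<tau> $ k - \<gamma> \<tau> $ j))" for h
  proof -
    have "(\<Prod>j\<in>UNIV - {i}. \<gamma> \<tau> $ k - \<gamma> \<tau> $ j) = 0" if "i \<noteq> k" for i
      using that by (intro prod_zero) auto
    then have "(\<Sum>i\<in>UNIV. (0 - h * v $ i) * (\<Prod>j\<in>UNIV - {i}. \<gamma> \<tau> $ k - \<gamma> \<tau> $ j))
      = (\<Sum>i\<in>{k}. (0 - h * v $ i) * (\<Prod>j\<in>UNIV - {i}. \<gamma> \<tau> $ k - \<gamma> \<tau> $ j))"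
      by (intro sum.mono_neutral_right) auto
    then show ?thesis by simp
  qed
  ultimately show ?thesis
    by (rule has_derivative_imp_has_field_derivative)
qed

text \<open>Injectivity of the Jacobian of the elementary symmetric polynomials. If all coefficients
  are stationary along \<open>x + s v\<close>, so is the polynomial's value at each root of
  \<open>x\<close>; that value has derivative \<open>- v $ k\<close> times a product of nonzero
  differences.\<close>

lemma esym_deriv_eq_0_imp:
  fixes x v :: "real ^ 'n"
  assumes "\<And>i j. i \<noteq> j \<Longrightarrow> x $ i \<noteq> x $ j"
    and zero: "\<And>k. 1 \<le> k \<Longrightarrow> k \<le> CARD('n) \<Longrightarrow> esym_deriv k x v = 0"
  shows "v = 0"
proof -
  define \<gamma> where "\<gamma> s = x + s *\<^sub>R v" for s :: real
  have \<gamma>: "(\<gamma> has_vector_derivative v) (at 0)"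
    unfolding \<gamma>_def by (auto intro!: derivative_eq_intros)
  have esym: "((\<lambda>s. esym k (\<gamma> s)) has_real_derivative 0) (at 0)" if "k \<le> CARD('n)" for k
  proof (cases "k = 0")
    case False
    have "((\<lambda>s. esym k (\<gamma> s)) has_derivative (\<lambda>h. esym_deriv k (\<gamma> 0) (h *\<^sub>R v))) (at 0)"
      using has_derivative_compose[OF \<gamma>[unfolded has_vector_derivative_def] has_derivative_esym] .
    moreover have "h * 0 = esym_deriv k (\<gamma> 0) (h *\<^sub>R v)" for h
      using zero[of k] that False
        linear_scale[OF has_derivative_linear[OF has_derivative_esym], of k x h v]
      by (simp add: \<gamma>_def)
    ultimately show ?thesis
      by (rule has_derivative_imp_has_field_derivative)
  qed (simp add: esym_0)
  have "v $ k = 0" for k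
  proof -
    \<comment> \<open>By Vieta this is a combination of stationary coefficients with constant
      weights.\<close>
    have "((\<lambda>s. \<Prod>i\<in>UNIV. \<gamma> 0 $ k - \<gamma> s $ i) has_real_derivative 0) (at 0)"
      unfolding prod_diff_eq_esym
      by (rule derivative_eq_intros esym refl | simp)+
    then have "v $ k * (\<Prod>i\<in>UNIV - {k}. \<gamma> 0 $ k - \<gamma> 0 $ i) = 0"
      using DERIV_unique[OF has_real_derivative_prod_diff_root[OF \<gamma>]] by fastforce
    moreover have "(\<Prod>i\<in>UNIV - {k}. \<gamma> 0 $ k - \<gamma> 0 $ i) \<noteq> 0"
      using assms(1) by (auto simp: \<gamma>_def)
    ultimately show ?thesis by simp
  qed
  then show ?thesis by (simp add: vec_eq_iff)
qed

subsection \<open>Existence of charts\<close>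

lemma C1_onI:
  assumes "\<And>u. u \<in> U \<Longrightarrow> (f has_derivative f' u) (at u)"
    and "\<And>v. continuous_on U (\<lambda>u. f' u v)"
  shows "C1_on U f"
proof -
  have "frechet_derivative f (at u) = f' u" if "u \<in> U" for u
    using frechet_derivative_at[OF assms(1)[OF that]] by simp
  then have "continuous_on U (\<lambda>u. frechet_derivative f (at u) v)" for v
    using assms(2)[of v] by (simp cong: continuous_on_cong)
  then show ?thesis
    unfolding C1_on_def using assms(1) by (auto simp: differentiable_def)
qed

lemma continuous_on_det [continuous_intros]:
  fixes A :: "'a::topological_space \<Rightarrow> real ^ 'n ^ 'n"
  assumes "\<And>i j. continuous_on S (\<lambda>y. A y $ i $ j)"
  shows "continuous_on S (\<lambda>y. det (A y))"
  unfolding det_def by (intro continuous_intros assms)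

text \<open>By Cramer's rule the inverse is a quotient of determinants.\<close>

lemma continuous_on_inv_linear:
  fixes L :: "'a::topological_space \<Rightarrow> real ^ 'n \<Rightarrow> real ^ 'n"
  assumes lin: "\<And>y. y \<in> S \<Longrightarrow> linear (L y)"
    and bij: "\<And>y. y \<in> S \<Longrightarrow> bij (L y)"
    and cont: "\<And>v. continuous_on S (\<lambda>y. L y v)"
  shows "continuous_on S (\<lambda>y. inv (L y) w)"
proof -
  define A where "A y = matrix (L y)" for y
  have A: "A y *v v = L y v" if "y \<in> S" for y v
    using lin[OF that] by (simp add: A_def matrix_works linear_matrix_vector_mul_eq)
  have contA: "continuous_on S (\<lambda>y. A y $ i $ j)" for i j
    unfolding A_def matrix_def using cont[of "axis j 1"] by (simp add: continuous_on_component)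
  have det: "det (A y) \<noteq> 0" if "y \<in> S" for y
    using lin[OF that] bij[OF that] by (simp add: A_def det_nz_iff_inj bij_is_inj)
  have "inv (L y) w = (\<chi> k. det (\<chi> i j. if j = k then w $ i else A y $ i $ j) / det (A y))"
    if "y \<in> S" for y
  proof -
    have "A y *v inv (L y) w = w"
      using A[OF that] surj_f_inv_f[OF bij_is_surj[OF bij[OF that]]] by simp
    then show ?thesis by (simp only: cramer[OF det[OF that]])
  qed
  moreover have "continuous_on S
      (\<lambda>y. \<chi> k. det (\<chi> i j. if j = k then w $ i else A y $ i $ j) / det (A y))"
  proof (rule continuous_on_vec_lambda, rule continuous_on_divide)
    show "continuous_on S (\<lambda>y. det (\<chi> i j. if j = k then w $ i else A y $ i $ j))" for k
    proof (rule continuous_on_det)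
      show "continuous_on S (\<lambda>y. (\<chi> i j. if j = k then w $ i else A y $ i $ j) $ i $ j)" for i j
        using contA by (cases "j = k") simp_all
    qed
  qed (use det in \<open>auto intro: continuous_on_det contA\<close>)
  ultimately show ?thesis by (simp cong: continuous_on_cong)
qed

text \<open>The inverse function theorem, from directional data: in finite dimension, continuity in
  each direction gives continuity in operator norm, and injectivity gives the left inverse it
  requires.\<close>

lemma is_local_chart_exists:
  fixes t :: "real ^ 'n \<Rightarrow> real ^ 'n"
  assumes "open M" "a \<in> M"
    and der: "\<And>x. x \<in> M \<Longrightarrow> (t has_derivative t' x) (at x)"
    and cont: "\<And>v. continuous_on M (\<lambda>x. t' x v)"
    and inj: "inj (t' a)"
  shows "\<exists>U V g. is_local_chart M t a U V g"
proof -
  \<comment> \<open>\<open>Blinfun\<close> is meaningful only for bounded linear maps, so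
    \<open>T\<close> is used only on \<open>M\<close>.\<close>
  define T where "T x = Blinfun (t' x)" for x
  have T: "blinfun_apply (T x) = t' x" if "x \<in> M" for x
    unfolding T_def using has_derivative_bounded_linear[OF der[OF that]]
    by (rule bounded_linear_Blinfun_apply)
  have contT: "continuous_on M T"
    using cont by (intro continuous_on_blinfun_componentwise) (simp add: T cong: continuous_on_cong)
  have "linear (t' a)" using der \<open>a \<in> M\<close> by (blast intro: has_derivative_linear)
  then obtain h where h: "linear h" "h \<circ> t' a = id"
    using linear_injective_left_inverse inj by blast
  have "blinfun_apply (Blinfun h) = h"
    using h(1) by (intro bounded_linear_Blinfun_apply) (simp add: linear_conv_bounded_linear)
  then have inv: "Blinfun h o\<^sub>L T a = id_blinfun"
    using h(2) T[OF \<open>a \<in> M\<close>] by (intro blinfun_eqI) (simp add: fun_eq_iff)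
  obtain U V g g' where U: "open U" "U \<subseteq> M" "a \<in> U" "open V" "homeomorphism U V t g"
    and g: "\<And>y. y \<in> V \<Longrightarrow> (g has_derivative (g' y)) (at y)"
    and g': "\<And>y. y \<in> V \<Longrightarrow> g' y = inv (blinfun_apply (T (g y)))"
    and bij: "\<And>y. y \<in> V \<Longrightarrow> bij (blinfun_apply (T (g y)))"
    using inverse_function_theorem[OF \<open>open M\<close> _ contT \<open>a \<in> M\<close> inv, of t] der T by metis
  have gV: "g ` V = U" and contg: "continuous_on V g"
    using U(5) by (auto simp: homeomorphism_def)
  have "C1_on U t"
    using U(2) by (intro C1_onI[of U t t']) (auto intro: der continuous_on_subset[OF cont])
  \<comment> \<open>The derivative of \<open>g\<close> at \<open>y\<close> is the inverse of the
    derivative of \<open>t\<close> at \<open>g y\<close>, hence continuous in \<open>y\<close> by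
    Cramer's rule.\<close>
  moreover have "C1_on V g"
  proof (rule C1_onI[OF g])
    fix v
    have "continuous_on V (\<lambda>y. blinfun_apply (T (g y)) w)" for w
      using continuous_on_compose2[OF contT contg] gV U(2)
      by (intro continuous_intros) auto
    then have "continuous_on V (\<lambda>y. inv (blinfun_apply (T (g y))) v)"
      using bij by (intro continuous_on_inv_linear) (auto intro: bounded_linear.linear blinfun.bounded_linear_right)
    then show "continuous_on V (\<lambda>y. g' y v)"
      by (simp add: g' cong: continuous_on_cong)
  qed
  ultimately show ?thesis
    unfolding is_local_chart_def using U by blast
qed

lemma open_distinct_positive: "open (distinct_positive :: (real ^ 'n) set)"
proof -
  have "(distinct_positive :: (real ^ 'n) set)
      = (\<Inter>i. {x. 0 < x $ i}) \<inter> (\<Inter>i. \<Inter>j\<in>UNIV - {i}. {x. x $ i \<noteq> x $ j})"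
    by (auto simp: distinct_positive_def)
  also have "open \<dots>"
    by (intro open_Int open_INT ballI open_Collect_less open_Collect_neq continuous_intros) auto
  finally show ?thesis .
qed

section \<open>The Jacobian of the coordinate map\<close>

lemma esym_1_pos: "x \<in> distinct_positive \<Longrightarrow> 0 < esym 1 x"
  unfolding esym_1 distinct_positive_def by (auto intro: sum_pos)

definition tcoords_deriv :: "('n \<Rightarrow> nat) \<Rightarrow> real ^ 'n \<Rightarrow> real ^ 'n \<Rightarrow> real ^ 'n" where
  "tcoords_deriv idx x v =
     (\<chi> j. if idx j = 1 then - esym_deriv 1 x v / (esym 1 x)\<^sup>2
           else (esym_deriv (idx j) x v * esym 1 x - esym (idx j) x * esym_deriv 1 x v) / (esym 1 x)\<^sup>2)"

lemma has_derivative_tcoords: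
  fixes x :: "real ^ 'n"
  assumes "esym 1 x \<noteq> 0"
  shows "(tcoords idx has_derivative tcoords_deriv idx x) (at x)"
proof -
  have "((\<lambda>x. tcoords idx x $ j) has_derivative (\<lambda>v. tcoords_deriv idx x v $ j)) (at x)" for j
  proof (cases "idx j = 1")
    case True
    then show ?thesis using assms unfolding tcoords_def tcoords_deriv_def
      by (auto intro!: derivative_eq_intros has_derivative_esym simp: fun_eq_iff field_simps power2_eq_square)
  next
    case False
    then show ?thesis using assms unfolding tcoords_def tcoords_deriv_def
      by (auto intro!: derivative_eq_intros has_derivative_esym simp: fun_eq_iff field_simps power2_eq_square)
  qed
  then show ?thesis
    by (subst has_derivative_componentwise_within) (auto simp: Basis_vec_def inner_axis)
qed

lemma tcoords_chart_exists:
  fixes x :: "real ^ 'n"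
  assumes idx: "bij_betw idx UNIV {1..CARD('n)}"
    and x: "x \<in> distinct_positive"
  shows "\<exists>U V g. is_local_chart distinct_positive (tcoords idx) x U V g"
proof (rule is_local_chart_exists[OF open_distinct_positive x])
  show der: "(tcoords idx has_derivative tcoords_deriv idx y) (at y)"
    if "y \<in> distinct_positive" for y
    using esym_1_pos[OF that] by (intro has_derivative_tcoords) simp
  show "continuous_on distinct_positive (\<lambda>y. tcoords_deriv idx y v)" for v
  proof -
    have "continuous_on distinct_positive (\<lambda>y. tcoords_deriv idx y v $ j)" for j
    proof (cases "idx j = 1")
      case True
      show ?thesis unfolding tcoords_deriv_def vec_lambda_beta if_P[OF True]
        by (intro continuous_intros) (auto dest: esym_1_pos)
    next
      case False
      show ?thesis unfolding tcoords_deriv_def vec_lambda_beta if_not_P[OF False]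
        by (intro continuous_intros) (auto dest: esym_1_pos)
    qed
    from continuous_on_vec_lambda[of _ "\<lambda>j y. tcoords_deriv idx y v $ j", OF this]
    show ?thesis by simp
  qed
  have pos: "0 < esym 1 x" using esym_1_pos[OF x] .
  have onto: "\<exists>j. idx j = k" if "1 \<le> k" "k \<le> CARD('n)" for k
  proof -
    have "k \<in> range idx"
      using idx that by (simp add: bij_betw_def)
    then show ?thesis by blast
  qed
  have "v = 0" if "tcoords_deriv idx x v = 0" for v
  proof (rule esym_deriv_eq_0_imp)
    show "x $ i \<noteq> x $ j" if "i \<noteq> j" for i j
      using that x by (auto simp: distinct_positive_def)
    have comp: "tcoords_deriv idx x v $ j = 0" for j using that by simp
    \<comment> \<open>The row of \<open>t\<^sub>1\<close> forces the variation of
      \<open>s\<^sub>1\<close> to vanish; the numerators of the other rows then reduce to the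
      variation of \<open>s\<^sub>k\<close> times \<open>s\<^sub>1\<close>, which is
      positive.\<close>
    obtain j where "idx j = 1" using onto[of 1] by (auto simp: Suc_le_eq)
    with comp[of j] pos have one: "esym_deriv 1 x v = 0" by (simp add: tcoords_deriv_def)
    show "esym_deriv k x v = 0" if k: "1 \<le> k" "k \<le> CARD('n)" for k
    proof (cases "k = 1")
      case False
      obtain j where "idx j = k" using onto[OF k] by blast
      with False comp[of j] one pos show ?thesis by (simp add: tcoords_deriv_def)
    qed (use one in simp)
  qed
  then show "inj (tcoords_deriv idx x)"
    using linear_injective_0[OF has_derivative_linear[OF der[OF x]]] by blast
qed

subsection \<open>Motion along the first coordinate line\<close>

text \<open>The chart is arbitrary because \<open>has_coord_partial\<close> demands the same value
  from every chart.\<close>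

lemma shannon_entropy_coordinate_derivative:
  fixes x :: "real ^ 'n"
  assumes idx: "bij_betw idx UNIV {1..CARD('n)}" and j1: "idx j1 = 1"
    and x: "x \<in> distinct_positive" and s1: "esym 1 x = 1"
    and chart: "is_local_chart distinct_positive (tcoords idx) x U V g"
  shows "((\<lambda>\<tau>. shannon_entropy (g (\<chi> i. if i = j1 then \<tau> else tcoords idx x $ i)))
           has_real_derivative 1 - subentropy x) (at (tcoords idx x $ j1))"
proof -
  \<comment> \<open>\<open>p\<close> is the coordinate line through the image of \<open>x\<close>,
    and \<open>\<gamma>\<close> its lift by the chart. Since \<open>s\<^sub>1 = 1\<close> at
    \<open>x\<close>, the base parameter is \<open>1\<close>.\<close>
  define p where "p \<tau> = (\<chi> i. if i = j1 then \<tau> else tcoords idx x $ i)" for \<tau>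
  define \<gamma> where "\<gamma> \<tau> = g (p \<tau>)" for \<tau>
  have one: "tcoords idx x $ j1 = 1" using j1 s1 by (simp add: tcoords_def)
  then have p1: "p 1 = tcoords idx x" by (auto simp: p_def vec_eq_iff)
  have hom: "homeomorphism U V (tcoords idx) g" and U: "x \<in> U" "U \<subseteq> distinct_positive"
    and V: "open V" and C1: "C1_on V g"
    using chart by (auto simp: is_local_chart_def)
  have p1V: "p 1 \<in> V" and \<gamma>1: "\<gamma> 1 = x"
    using hom U unfolding \<gamma>_def p1 homeomorphism_def by auto
  have p_eq: "p = (\<lambda>\<tau>. p 1 + (\<tau> - 1) *\<^sub>R axis j1 1)"
    by (auto simp: p_def vec_eq_iff axis_def)
  have p': "(p has_derivative (\<lambda>h. h *\<^sub>R axis j1 1)) (at 1)"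
    by (subst p_eq) (auto intro!: derivative_eq_intros)
  define v where "v = frechet_derivative g (at (p 1)) (axis j1 1)"
  have g': "(g has_derivative frechet_derivative g (at (p 1))) (at (p 1))"
    using C1 p1V by (auto simp: C1_on_def frechet_derivative_works)
  have \<gamma>': "(\<gamma> has_vector_derivative v) (at 1)"
    using has_derivative_compose[OF p' g'] linear_scale[OF has_derivative_linear[OF g']]
    by (simp add: has_vector_derivative_def \<gamma>_def[abs_def] v_def)
  have "continuous (at 1) p"
    using p' by (rule has_derivative_continuous)
  \<comment> \<open>The line stays in the open set \<open>V\<close> near \<open>1\<close>, and there
    \<open>tcoords idx\<close> undoes \<open>g\<close>.\<close>
  then have "\<forall>\<^sub>F \<tau> in nhds 1. p \<tau> \<in> V"
    using V p1V by (simp add: continuous_at eventually_nhds_conv_at topological_tendstoD)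
  moreover have "\<forall>\<^sub>F \<tau> in nhds (1::real). 0 < \<tau>"
    by (rule eventually_nhds_in_open[of "{0<..}", simplified]) auto
  ultimately have ev: "\<forall>\<^sub>F \<tau> in nhds 1. 0 < \<tau> \<and> tcoords idx (\<gamma> \<tau>) = p \<tau>"
    by eventually_elim (use hom in \<open>auto simp: \<gamma>_def homeomorphism_def\<close>)
  have esym_\<gamma>: "esym k (\<gamma> \<tau>) = esym k x / \<tau>"
    if \<tau>: "0 < \<tau> \<and> tcoords idx (\<gamma> \<tau>) = p \<tau>" and k: "1 \<le> k" "k \<le> CARD('n)" for k \<tau>
  proof -
    have eq: "tcoords idx (\<gamma> \<tau>) $ j = (if j = j1 then \<tau> else tcoords idx x $ j)" for j
      using \<tau> by (simp add: p_def)
    have "1 / esym 1 (\<gamma> \<tau>) = \<tau>"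
      using eq[of j1] j1 by (simp add: tcoords_def)
    \<comment> \<open>\<open>1 / (1 / a) = a\<close> holds for every real \<open>a\<close>,
      including \<open>0\<close> since \<open>1 / 0 = 0\<close>.\<close>
    then have e1: "esym 1 (\<gamma> \<tau>) = 1 / \<tau>"
      by (metis div_by_1 divide_divide_eq_right mult_1)
    have "k \<in> range idx"
      using idx k by (simp add: bij_betw_def)
    then obtain j where j: "idx j = k" by blast
    show ?thesis
    proof (cases "k = 1")
      case False
      \<comment> \<open>For \<open>k > 1\<close> the ratio \<open>s\<^sub>k / s\<^sub>1\<close> is
        frozen at its value at \<open>x\<close>, which is \<open>s\<^sub>k(x)\<close> because
        \<open>s\<^sub>1(x) = 1\<close>.\<close>
      with j j1 have "j \<noteq> j1" by auto
      with eq[of j] j False s1 have "esym k (\<gamma> \<tau>) / esym 1 (\<gamma> \<tau>) = esym k x"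
        by (simp add: tcoords_def)
      then have "esym k (\<gamma> \<tau>) * \<tau> = esym k x" by (simp only: e1) simp
      with \<tau> show ?thesis by (simp add: field_simps)
    qed (use e1 s1 in simp)
  qed
  have vel: "v $ k * (\<Prod>i\<in>UNIV - {k}. x $ k - x $ i) = - (x $ k ^ CARD('n))" for k
  proof -
    have poly: "(\<Prod>i\<in>UNIV. z - \<gamma> \<tau> $ i) = z ^ CARD('n) + ((\<Prod>i\<in>UNIV. z - x $ i) - z ^ CARD('n)) / \<tau>"
      if "0 < \<tau> \<and> tcoords idx (\<gamma> \<tau>) = p \<tau>" for \<tau> z
    proof -
      \<comment> \<open>The term \<open>k = 0\<close> is split off: the leading coefficient is
        always \<open>1\<close>, while all others scale by \<open>1 / \<tau>\<close>.\<close>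
      have split: "(\<Prod>i\<in>UNIV. z - y $ i) = z ^ CARD('n) +
          (\<Sum>k=1..CARD('n). (-1) ^ k * z ^ (CARD('n) - k) * esym k y)" for y :: "real ^ 'n"
        unfolding prod_diff_eq_esym atMost_atLeast0
        by (subst sum.atLeast_Suc_atMost) (auto simp: esym_0)
      show ?thesis
        unfolding split by (simp add: esym_\<gamma>[OF that] sum_divide_distrib)
    qed
    have zero: "(\<Prod>i\<in>UNIV. x $ k - x $ i) = 0" by (intro prod_zero) auto
    \<comment> \<open>At \<open>z = x $ k\<close> the polynomial of \<open>x\<close> vanishes,
      leaving only the powers of \<open>x $ k\<close>.\<close>
    have ev': "\<forall>\<^sub>F \<tau> in nhds 1. (\<Prod>i\<in>UNIV. \<gamma> 1 $ k - \<gamma> \<tau> $ i)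
        = x $ k ^ CARD('n) - x $ k ^ CARD('n) / \<tau>"
      using ev by eventually_elim (simp add: poly zero \<gamma>1)
    have "((\<lambda>\<tau>. x $ k ^ CARD('n) - x $ k ^ CARD('n) / \<tau>) has_real_derivative x $ k ^ CARD('n)) (at 1)"
      by (auto intro!: derivative_eq_intros)
    then have "((\<lambda>\<tau>. \<Prod>i\<in>UNIV. \<gamma> 1 $ k - \<gamma> \<tau> $ i) has_real_derivative x $ k ^ CARD('n)) (at 1)"
      using DERIV_cong_ev[OF refl ev' refl] by simp
    from DERIV_unique[OF has_real_derivative_prod_diff_root[OF \<gamma>'] this]
    show ?thesis by (simp add: \<gamma>1)
  qed
  have comp: "((\<lambda>\<tau>. \<gamma> \<tau> $ i) has_real_derivative v $ i) (at 1)" for i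
    using bounded_linear.has_vector_derivative[OF bounded_linear_vec_nth \<gamma>']
    by (simp add: has_real_derivative_iff_has_vector_derivative)
  have sum_v: "(\<Sum>i\<in>UNIV. v $ i) = -1"
  proof -
    have n: "1 \<le> CARD('n)" by (simp add: Suc_le_eq)
    have ev1: "\<forall>\<^sub>F \<tau> in nhds 1. (\<Sum>i\<in>UNIV. \<gamma> \<tau> $ i) = 1 / \<tau>"
      using ev by eventually_elim (simp add: esym_1[symmetric] esym_\<gamma>[OF _ order_refl n] s1 del: One_nat_def)
    have "((\<lambda>\<tau>. 1 / \<tau>) has_real_derivative -1) (at 1)"
      by (auto intro!: derivative_eq_intros)
    then have "((\<lambda>\<tau>. \<Sum>i\<in>UNIV. \<gamma> \<tau> $ i) has_real_derivative -1) (at 1)"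
      using DERIV_cong_ev[OF refl ev1 refl] by simp
    from DERIV_unique[OF DERIV_sum[OF comp, of "\<lambda>i. i" UNIV] this] show ?thesis .
  qed
  have pos: "0 < x $ i" and neq: "i \<noteq> k \<Longrightarrow> x $ i \<noteq> x $ k" for i k
    using x by (auto simp: distinct_positive_def)
  \<comment> \<open>The derivative of \<open>y ln y\<close> is \<open>ln y + 1\<close>. The
    logarithms produce the subentropy; the extra \<open>v $ i\<close> add up to \<open>-1\<close>
    and give the constant \<open>1\<close> of the formula.\<close>
  have "((\<lambda>\<tau>. \<gamma> \<tau> $ i * ln (\<gamma> \<tau> $ i)) has_real_derivative v $ i * ln (x $ i) + v $ i) (at 1)" for i
    using pos[of i] by (auto intro!: derivative_eq_intros comp simp: \<gamma>1)
  then have "((\<lambda>\<tau>. shannon_entropy (\<gamma> \<tau>)) has_real_derivative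
      - (\<Sum>i\<in>UNIV. v $ i * ln (x $ i) + v $ i)) (at 1)"
    unfolding shannon_entropy_def by (intro DERIV_minus DERIV_sum)
  moreover have "- (\<Sum>i\<in>UNIV. v $ i * ln (x $ i) + v $ i) = 1 - subentropy x"
  proof -
    have "v $ k = - (x $ k ^ CARD('n) / (\<Prod>i\<in>UNIV - {k}. x $ k - x $ i))" for k
    proof -
      have "(\<Prod>i\<in>UNIV - {k}. x $ k - x $ i) \<noteq> 0" using neq by fastforce
      then show ?thesis using vel[of k] by (simp add: field_simps)
    qed
    then have "subentropy x = (\<Sum>i\<in>UNIV. v $ i * ln (x $ i))"
      unfolding subentropy_def by (simp add: sum_negf[symmetric])
    then show ?thesis by (simp add: sum.distrib sum_v)
  qed
  ultimately show ?thesis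
    unfolding one by (simp add: \<gamma>_def p_def)
qed

theorem theorem2:
  fixes x :: "real ^ 'n" and idx :: "'n \<Rightarrow> nat" and j1 :: 'n
  assumes "bij_betw idx UNIV {1..CARD('n)}"
    and "idx j1 = 1"
    and "x \<in> distinct_positive"
    and "esym 1 x = 1"
  shows "\<exists>D. has_coord_partial distinct_positive (tcoords idx) shannon_entropy j1 D x \<and>
             subentropy x = 1 - D"
proof (intro exI conjI)
  \<comment> \<open>With \<open>D = 1 - subentropy x\<close> the second conjunct is mere
    arithmetic.\<close>
  show "has_coord_partial distinct_positive (tcoords idx) shannon_entropy j1 (1 - subentropy x) x"
    unfolding has_coord_partial_def
    using tcoords_chart_exists[OF assms(1,3)] shannon_entropy_coordinate_derivative[OF assms]
    by blast
qed simp

end
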